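(* Assume that the stochastic process is represented by a finite scenario tree (the set $\Xi$ of possible sample paths is finite), and that the multistage stochastic mixed-integer program described in the context satisfies the relatively complete recourse and boundedness assumptions stated there. Given any set of basis functions $\Phi_t=(\Phi_{t1},\dots,\Phi_{tK_t})$, $t\in[T]$, used in the restricted stagewise Lagrangian dual, there exist basis functions $\Psi_t=(\Psi_{t1},\dots,\Psi_{tK'_t})$, $t\in[T]$ (for some numbers $K'_t$), for the restricted nonanticipative Lagrangian dual such that $$\nu_R^{\mathrm{SW}}\le \nu_R^{\mathrm{NA}},$$ where $\nu_R^{\mathrm{SW}}$ is the optimal value of the restricted stagewise dual defined by $\Phi$ and $\nu_R^{\mathrm{NA}}$ is the optimal value of the restricted nonanticipative dual defined by $\Psi$.
   Context: Notation: $[a]=\{1,\dots,a\}$; $[a,b]=\{a,\dots,b\}$. Stochastic process. $T$ is the number of stages. $\boldsymbol\xi^T=(\boldsymbol\xi_1,\dots,\boldsymbol\xi_T)$ is a stochastic process with distribution $\mathbb P$ and support $\Xi$, where $\boldsymbol\xi_t$ takes values in $\mathbb R^{\ell_t}$ and $\boldsymbol\xi_1=1$ is deterministic. $\boldsymbol\xi^t=(\boldsymbol\xi_1,\dots,\boldsymbol\xi_t)$ is the history at stage $t$, with values in $\mathbb R^{\ell^t}$, $\ell^t=\sum_{t'=1}^t\ell_{t'}$. In the present statement $\Xi$ is finite, and every sample path in $\Xi$ has positive probability. $\boldsymbol\xi'^T$ denotes a random path with the same distribution as $\boldsymbol\xi^T$, and $\mathbb E_{\boldsymbol\xi'^T}[\,f(\boldsymbol\xi'^T)\mid\boldsymbol\xi'^t=\boldsymbol\xi^t]$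 is the conditional expectation given the history $\boldsymbol\xi^t$. Problem. The multistage stochastic mixed-integer program (MSMIP) is to minimize $\mathbb E\big[\sum_{t\in[T]}c_t(\boldsymbol\xi^t)^\top x_t(\boldsymbol\xi^t)\big]$ over policies $x_t(\cdot)$ (functions of the history $\boldsymbol\xi^t$) subject to, for all $t\in[T]$ and $\mathbb P$-a.e. $\boldsymbol\xi^T\in\Xi$, the state equations $$A_t(\boldsymbol\xi^t)x_t(\boldsymbol\xi^t)+B_t(\boldsymbol\xi^t)x_{t-1}(\boldsymbol\xi^{t-1})=b_t(\boldsymbol\xi^t)$$ and $x_t(\boldsymbol\xi^t)\in X_t(\boldsymbol\xi^t)$, with the convention $x_0\equiv0$. Here $c_t(\cdot)\in\mathbb R^{n_t}$, $A_t(\cdot)\in\mathbb R^{m_t\times n_t}$, $B_t(\cdot)\in\mathbb R^{m_t\times n_{t-1}}$, $b_t(\cdot)\in\mathbb R^{m_t}$ are functions on $\mathbb R^{\ell^t}$ ($m_t$ is the number of state equations at stage $t$), and $X_t(\boldsymbol\xi^t)=\{x\in\mathbb Z^{p_t}\times\mathbb R^{n_t-p_t}:C_t(\boldsymbol\xi^t)x\ge d_t(\boldsymbol\xi^t)\}$ for given matrix- and vector-valued functions $C_t,d_t$ of the history. Standing assumptions. (Relatively complete recourse) For each stage $t\in[T]$, every possible history $\boldsymbol\xi^t$ and every sequence of feasible decisions $x_s(\boldsymbol\xi^s)$, $s\in[1,t-1]$, there exists a feasible decision $x_t(\boldsymbol\xi^t)$. (Boundedness) $X_t(\boldsymbol\xi^t)$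 is compact for all $t\in[T]$ and $\mathbb P$-a.e. $\boldsymbol\xi^T\in\Xi$, and $\mathbb E[\mathrm{dia}(X_t(\boldsymbol\xi^t))]$ is finite, where $\mathrm{dia}(S)=\max\{\|x-y\|_2:x,y\in S\}$. Stagewise (SW) dual. For functions $\pi_t:\mathbb R^{\ell^t}\to\mathbb R^{m_t}$, $t\in[T]$, let $$\mathfrak L^{\mathrm{SW}}(\pi_1,\dots,\pi_T)=\min_{\{x_t(\cdot)\}}\ \mathbb E\Big[\sum_{t\in[T]}c_t(\boldsymbol\xi^t)^\top x_t(\boldsymbol\xi^t)+\pi_t(\boldsymbol\xi^t)^\top\big(A_t(\boldsymbol\xi^t)x_t(\boldsymbol\xi^t)+B_t(\boldsymbol\xi^t)x_{t-1}(\boldsymbol\xi^{t-1})-b_t(\boldsymbol\xi^t)\big)\Big]$$ subject to $x_t(\boldsymbol\xi^t)\in X_t(\boldsymbol\xi^t)$ for $t\in[T]$ and $\mathbb P$-a.e. $\boldsymbol\xi^T\in\Xi$. Basis functions for the SW dual are functions $\Phi_t:\mathbb R^{\ell^t}\to\mathbb R^{m_t\times K_t}$, with columns $\Phi_{t1},\dots,\Phi_{tK_t}$, and the restricted SW dual is $$\nu_R^{\mathrm{SW}}=\max_{\beta_t\in\mathbb R^{K_t},\,t\in[T]}\ \mathfrak L^{\mathrm{SW}}(\Phi_1\beta_1,\dots,\Phi_T\beta_T).$$ Nonanticipative (NA) dual. Let $Y(\boldsymbol\xi^T)$ be the set of $y=(y_1,\dots,y_T)$ with $y_t\in\mathbb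 Z^{p_t}\times\mathbb R^{n_t-p_t}$, $A_t(\boldsymbol\xi^t)y_t+B_t(\boldsymbol\xi^t)y_{t-1}=b_t(\boldsymbol\xi^t)$ and $y_t\in X_t(\boldsymbol\xi^t)$ for all $t\in[T]$ (with $y_0=0$). For functions $\gamma_t:\mathbb R^{\ell^T}\to\mathbb R^{n_t}$, $t\in[T]$, let $$\mathfrak L^{\mathrm{NA}}(\gamma_1,\dots,\gamma_T)=\min_{\{y_t(\cdot)\}}\ \mathbb E_{\boldsymbol\xi^T}\Big[\sum_{t\in[T]}c_t(\boldsymbol\xi^t)^\top y_t(\boldsymbol\xi^T)+\gamma_t(\boldsymbol\xi^T)^\top\big(y_t(\boldsymbol\xi^T)-\mathbb E_{\boldsymbol\xi'^T}[y_t(\boldsymbol\xi'^T)\mid\boldsymbol\xi'^t=\boldsymbol\xi^t]\big)\Big]$$ subject to $y(\boldsymbol\xi^T)=(y_1(\boldsymbol\xi^T),\dots,y_T(\boldsymbol\xi^T))\in Y(\boldsymbol\xi^T)$ for $\mathbb P$-a.e. $\boldsymbol\xi^T\in\Xi$ (here the $y_t$ may depend on the entire path). Basis functions for the NA dual are functions $\Psi_t:\mathbb R^{\ell^T}\to\mathbb R^{n_t\times K'_t}$, with columns $\Psi_{t1},\dots,\Psi_{tK'_t}$, and the restricted NA dual is $$\nu_R^{\mathrm{NA}}=\max_{\alpha_t\in\mathbb R^{K'_t},\,t\in[T]}\ \mathfrak L^{\mathrm{NA}}(\Psi_1\alpha_1,\dots,\Psi_T\alpha_T).$$ *)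

theory Defs
  imports
    "HOL-Probability.Probability"
    "Jordan_Normal_Form.Matrix"
begin

text \<open>
  Sample paths and histories are lists of real vectors: the path \<open>\<xi>\<close> has the
  stage-\<open>t\<close> observation \<open>\<xi> ! (t - 1)\<close> and the stage-\<open>t\<close> history \<open>take t \<xi>\<close>. Stages are
  numbered from 1 to \<open>horizon\<close>, and all dimensions may vary with the stage. The process
  is given by the law of the whole path; its support is the set of paths of positive
  probability.
\<close>

record msmip =
  horizon :: nat
  path_law :: "real vec list pmf"
  obs_dim :: "nat \<Rightarrow> nat"      \<comment> \<open>dimension of the observation at stage \<open>t\<close>\<close>
  var_dim :: "nat \<Rightarrow> nat"      \<comment> \<open>\<open>n\<^sub>t\<close>\<close>
  int_dim :: "nat \<Rightarrow> nat"      \<comment> \<open>\<open>p\<^sub>t\<close>\<close>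
  eq_dim :: "nat \<Rightarrow> nat"       \<comment> \<open>\<open>m\<^sub>t\<close>, number of state equations\<close>
  ineq_dim :: "nat \<Rightarrow> nat"     \<comment> \<open>number of rows of \<open>C\<^sub>t\<close>\<close>
  cost :: "nat \<Rightarrow> real vec list \<Rightarrow> real vec"
  A_mat :: "nat \<Rightarrow> real vec list \<Rightarrow> real mat"
  B_mat :: "nat \<Rightarrow> real vec list \<Rightarrow> real mat"
  b_vec :: "nat \<Rightarrow> real vec list \<Rightarrow> real vec"
  C_mat :: "nat \<Rightarrow> real vec list \<Rightarrow> real mat"
  d_vec :: "nat \<Rightarrow> real vec list \<Rightarrow> real vec"

definition stage_set :: "msmip \<Rightarrow> nat set" where
  "stage_set M = {1..horizon M}"

definition support :: "msmip \<Rightarrow> real vec list set" where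
  "support M = set_pmf (path_law M)"

text \<open>The space \<open>\<real>\<^bsup>\<ell>\<^esup>\<close> of stage-\<open>t\<close> histories, \<open>\<ell>\<close> being the sum of the first \<open>t\<close>
  observation dimensions.\<close>

definition hist_space :: "msmip \<Rightarrow> nat \<Rightarrow> real vec list set" where
  "hist_space M t = {h. length h = t \<and> (\<forall>i<t. h ! i \<in> carrier_vec (obs_dim M (Suc i)))}"

definition well_formed :: "msmip \<Rightarrow> bool" where
  "well_formed M \<longleftrightarrow>
     1 \<le> horizon M \<and>
     obs_dim M 1 = 1 \<and>
     support M \<subseteq> hist_space M (horizon M) \<and>
     (\<forall>\<xi>\<in>support M. \<xi> ! 0 = vec 1 (\<lambda>_. 1)) \<and>
     (\<forall>t\<in>stage_set M. int_dim M t \<le> var_dim M t) \<and>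
     (\<forall>t\<in>stage_set M. \<forall>h\<in>hist_space M t.
        cost M t h \<in> carrier_vec (var_dim M t) \<and>
        A_mat M t h \<in> carrier_mat (eq_dim M t) (var_dim M t) \<and>
        B_mat M t h \<in> carrier_mat (eq_dim M t) (var_dim M (t - 1)) \<and>
        b_vec M t h \<in> carrier_vec (eq_dim M t) \<and>
        C_mat M t h \<in> carrier_mat (ineq_dim M t) (var_dim M t) \<and>
        d_vec M t h \<in> carrier_vec (ineq_dim M t))"

definition mixed_integer :: "msmip \<Rightarrow> nat \<Rightarrow> real vec set" where
  "mixed_integer M t = {x \<in> carrier_vec (var_dim M t). \<forall>i<int_dim M t. x $ i \<in> \<int>}"

definition X_set :: "msmip \<Rightarrow> nat \<Rightarrow> real vec list \<Rightarrow> real vec set" where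
  "X_set M t h = {x \<in> mixed_integer M t. C_mat M t h *\<^sub>v x \<ge> d_vec M t h}"

text \<open>The decision preceding stage \<open>t\<close> in a sequence of decisions, with \<open>x\<^sub>0 = 0\<close>.\<close>

definition prev :: "msmip \<Rightarrow> (nat \<Rightarrow> real vec) \<Rightarrow> nat \<Rightarrow> real vec" where
  "prev M x t = (if t = 1 then 0\<^sub>v (var_dim M 0) else x (t - 1))"

definition state_lhs :: "msmip \<Rightarrow> nat \<Rightarrow> real vec list \<Rightarrow> (nat \<Rightarrow> real vec) \<Rightarrow> real vec" where
  "state_lhs M t h x = A_mat M t h *\<^sub>v x t + B_mat M t h *\<^sub>v prev M x t"

definition feasible_at :: "msmip \<Rightarrow> nat \<Rightarrow> real vec list \<Rightarrow> (nat \<Rightarrow> real vec) \<Rightarrow> bool" where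
  "feasible_at M t h x \<longleftrightarrow> x t \<in> X_set M t h \<and> state_lhs M t h x = b_vec M t h"

definition relatively_complete_recourse :: "msmip \<Rightarrow> bool" where
  "relatively_complete_recourse M \<longleftrightarrow>
     (\<forall>t\<in>stage_set M. \<forall>\<xi>\<in>support M. \<forall>x.
        (\<forall>s\<in>{1..<t}. feasible_at M s (take s \<xi>) x) \<longrightarrow>
        (\<exists>v. feasible_at M t (take t \<xi>) (x(t := v))))"

text \<open>Euclidean distance on \<open>carrier_vec n\<close>. The type of vectors carries no topology, so
  compactness below refers to the metric topology of this distance.\<close>

definition vdist :: "nat \<Rightarrow> real vec \<Rightarrow> real vec \<Rightarrow> real" where
  "vdist n x y = L2_set (\<lambda>i. x $ i - y $ i) {..<n}"

lemma Metric_space_vdist: "Metric_space (carrier_vec n) (vdist n)"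
proof
  show "0 \<le> vdist n x y" for x y
    by (simp add: vdist_def)
  show "vdist n x y = vdist n y x" for x y
    by (simp add: vdist_def L2_set_def power2_commute)
  show "vdist n x y = 0 \<longleftrightarrow> x = y" if "x \<in> carrier_vec n" "y \<in> carrier_vec n" for x y
    using that by (auto simp: vdist_def L2_set_eq_0_iff)
  show "vdist n x z \<le> vdist n x y + vdist n y z" for x y z
    using L2_set_triangle_ineq[of "\<lambda>i. x $ i - y $ i" "\<lambda>i. y $ i - z $ i" "{..<n}"]
    by (simp add: vdist_def)
qed

definition vec_topology :: "nat \<Rightarrow> real vec topology" where
  "vec_topology n = Metric_space.mtopology (carrier_vec n) (vdist n)"

definition dia :: "nat \<Rightarrow> real vec set \<Rightarrow> ennreal" where
  "dia n S = (SUP x\<in>S. SUP y\<in>S. ennreal (vdist n x y))"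

definition bounded_decisions :: "msmip \<Rightarrow> bool" where
  "bounded_decisions M \<longleftrightarrow>
     (\<forall>t\<in>stage_set M. \<forall>\<xi>\<in>support M.
        compactin (vec_topology (var_dim M t)) (X_set M t (take t \<xi>))) \<and>
     (\<forall>t\<in>stage_set M.
        (\<integral>\<^sup>+\<xi>. dia (var_dim M t) (X_set M t (take t \<xi>)) \<partial>measure_pmf (path_law M)) < \<infinity>)"

text \<open>Optimal values are infima and suprema in the extended reals, so that no attainment or
  finiteness is presupposed. The support consists of the paths of positive probability, so
  quantifying over it is the same as quantifying over almost every path.\<close>

definition along :: "(nat \<Rightarrow> real vec list \<Rightarrow> real vec) \<Rightarrow> real vec list \<Rightarrow> nat \<Rightarrow> real vec" where
  "along x \<xi> t = x t (take t \<xi>)"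

definition SW_policies :: "msmip \<Rightarrow> (nat \<Rightarrow> real vec list \<Rightarrow> real vec) set" where
  "SW_policies M =
     {x. \<forall>\<xi>\<in>support M. \<forall>t\<in>stage_set M. x t (take t \<xi>) \<in> X_set M t (take t \<xi>)}"

definition SW_objective ::
    "msmip \<Rightarrow> (nat \<Rightarrow> real vec list \<Rightarrow> real vec) \<Rightarrow> (nat \<Rightarrow> real vec list \<Rightarrow> real vec) \<Rightarrow> real" where
  "SW_objective M \<pi> x = measure_pmf.expectation (path_law M) (\<lambda>\<xi>.
     \<Sum>t\<in>stage_set M.
       scalar_prod (cost M t (take t \<xi>)) (x t (take t \<xi>)) +
       scalar_prod (\<pi> t (take t \<xi>))
         (state_lhs M t (take t \<xi>) (along x \<xi>) - b_vec M t (take t \<xi>)))"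

definition SW_lagrangian :: "msmip \<Rightarrow> (nat \<Rightarrow> real vec list \<Rightarrow> real vec) \<Rightarrow> ereal" where
  "SW_lagrangian M \<pi> = (INF x\<in>SW_policies M. ereal (SW_objective M \<pi> x))"

definition SW_basis ::
    "msmip \<Rightarrow> (nat \<Rightarrow> nat) \<Rightarrow> (nat \<Rightarrow> real vec list \<Rightarrow> real mat) \<Rightarrow> bool" where
  "SW_basis M K \<Phi> \<longleftrightarrow>
     (\<forall>t\<in>stage_set M. \<forall>h\<in>hist_space M t. \<Phi> t h \<in> carrier_mat (eq_dim M t) (K t))"

definition coefficients :: "msmip \<Rightarrow> (nat \<Rightarrow> nat) \<Rightarrow> (nat \<Rightarrow> real vec) set" where
  "coefficients M K = {\<beta>. \<forall>t\<in>stage_set M. \<beta> t \<in> carrier_vec (K t)}"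

definition restricted_SW_value ::
    "msmip \<Rightarrow> (nat \<Rightarrow> nat) \<Rightarrow> (nat \<Rightarrow> real vec list \<Rightarrow> real mat) \<Rightarrow> ereal" where
  "restricted_SW_value M K \<Phi> =
     (SUP \<beta>\<in>coefficients M K. SW_lagrangian M (\<lambda>t h. \<Phi> t h *\<^sub>v \<beta> t))"

definition Y_set :: "msmip \<Rightarrow> real vec list \<Rightarrow> (nat \<Rightarrow> real vec) set" where
  "Y_set M \<xi> = {y. \<forall>t\<in>stage_set M. y t \<in> mixed_integer M t \<and>
     state_lhs M t (take t \<xi>) y = b_vec M t (take t \<xi>) \<and> y t \<in> X_set M t (take t \<xi>)}"

definition NA_policies :: "msmip \<Rightarrow> (nat \<Rightarrow> real vec list \<Rightarrow> real vec) set" where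
  "NA_policies M = {y. \<forall>\<xi>\<in>support M. (\<lambda>t. y t \<xi>) \<in> Y_set M \<xi>}"

text \<open>Componentwise conditional expectation of an \<open>n\<close>-dimensional function of the path, given
  that the stage-\<open>t\<close> history is \<open>h\<close>; only used for histories of positive probability.\<close>

definition cond_expect ::
    "msmip \<Rightarrow> nat \<Rightarrow> nat \<Rightarrow> (real vec list \<Rightarrow> real vec) \<Rightarrow> real vec list \<Rightarrow> real vec" where
  "cond_expect M n t f h = vec n (\<lambda>i.
     measure_pmf.expectation (cond_pmf (path_law M) {\<xi>'. take t \<xi>' = h}) (\<lambda>\<xi>'. f \<xi>' $ i))"

definition NA_objective ::
    "msmip \<Rightarrow> (nat \<Rightarrow> real vec list \<Rightarrow> real vec) \<Rightarrow> (nat \<Rightarrow> real vec list \<Rightarrow> real vec) \<Rightarrow> real" where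
  "NA_objective M \<gamma> y = measure_pmf.expectation (path_law M) (\<lambda>\<xi>.
     \<Sum>t\<in>stage_set M.
       scalar_prod (cost M t (take t \<xi>)) (y t \<xi>) +
       scalar_prod (\<gamma> t \<xi>) (y t \<xi> - cond_expect M (var_dim M t) t (y t) (take t \<xi>)))"

definition NA_lagrangian :: "msmip \<Rightarrow> (nat \<Rightarrow> real vec list \<Rightarrow> real vec) \<Rightarrow> ereal" where
  "NA_lagrangian M \<gamma> = (INF y\<in>NA_policies M. ereal (NA_objective M \<gamma> y))"

definition NA_basis ::
    "msmip \<Rightarrow> (nat \<Rightarrow> nat) \<Rightarrow> (nat \<Rightarrow> real vec list \<Rightarrow> real mat) \<Rightarrow> bool" where
  "NA_basis M K' \<Psi> \<longleftrightarrow> (\<forall>t\<in>stage_set M. \<forall>\<xi>\<in>hist_space M (horizon M).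
     \<Psi> t \<xi> \<in> carrier_mat (var_dim M t) (K' t))"

definition restricted_NA_value ::
    "msmip \<Rightarrow> (nat \<Rightarrow> nat) \<Rightarrow> (nat \<Rightarrow> real vec list \<Rightarrow> real mat) \<Rightarrow> ereal" where
  "restricted_NA_value M K' \<Psi> =
     (SUP \<alpha>\<in>coefficients M K'. NA_lagrangian M (\<lambda>t \<xi>. \<Psi> t \<xi> *\<^sub>v \<alpha> t))"

end

theory Submission
  imports Defs
begin

text \<open>
  Given multipliers \<open>\<pi>\<^sub>t = \<Phi>\<^sub>t \<beta>\<^sub>t\<close> of the state equations, use the nonanticipativity
  multipliers \<open>\<gamma>\<^sub>t = - B\<^sub>t\<^sub>+\<^sub>1\<^sup>T \<pi>\<^sub>t\<^sub>+\<^sub>1\<close>, which lie in the span of the basis functions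
  \<open>\<Psi>\<^sub>t = - B\<^sub>t\<^sub>+\<^sub>1\<^sup>T \<Phi>\<^sub>t\<^sub>+\<^sub>1\<close>. Since the decisions in the nonanticipative dual satisfy the state
  equations, its Lagrangian is then the expectation of the same stagewise linear functions of the
  decisions as in the stagewise dual: the \<open>\<gamma>\<^sub>t\<close> exactly replace \<open>B\<^sub>t\<^sub>+\<^sub>1\<^sup>T \<pi>\<^sub>t\<^sub>+\<^sub>1\<close> by its conditional
  expectation given the history. Among all paths through a node of the scenario tree, choosing
  the decision with the least such value turns a policy of the nonanticipative dual into
  a policy of the stagewise dual with no larger objective.
\<close>

section \<open>Conditional expectations under a law of finite support\<close>

text \<open>Drawing \<open>x\<close> from \<open>p\<close> and then \<open>y\<close> from
  \<open>p\<close> conditioned on the fibre of \<open>f\<close> through \<open>x\<close> gives an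
  exchangeable pair, so the two arguments of \<open>F\<close> may trade places. Finite support
  reduces this to a finite double sum with symmetric weights.\<close>

lemma expectation_cond_pmf_swap:
  fixes p :: "'a pmf" and f :: "'a \<Rightarrow> 'b" and F :: "'a \<Rightarrow> 'a \<Rightarrow> real"
  assumes fin: "finite (set_pmf p)"
  shows "measure_pmf.expectation p (\<lambda>x. measure_pmf.expectation (cond_pmf p {y. f y = f x}) (F x)) =
         measure_pmf.expectation p (\<lambda>x. measure_pmf.expectation (cond_pmf p {y. f y = f x}) (\<lambda>y. F y x))"
proof -
  define S where "S = set_pmf p"
  \<comment> \<open>The joint probability of the pair. It is symmetric because the normalizing fibre
    is the same for \<open>x\<close> and \<open>y\<close> whenever \<open>f y = f x\<close>.\<close>
  define w where "w x y = (if f y = f x then pmf p x * pmf p y / measure (measure_pmf p) {y. f y = f x} else 0)"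
    for x y
  have w_sym: "w x y = w y x" for x y
    by (simp add: w_def)
  have double_sum: "measure_pmf.expectation p (\<lambda>x. measure_pmf.expectation (cond_pmf p {y. f y = f x}) (G x)) =
      (\<Sum>x\<in>S. \<Sum>y\<in>S. w x y * G x y)" for G :: "'a \<Rightarrow> 'a \<Rightarrow> real"
  proof -
    have "pmf p x * measure_pmf.expectation (cond_pmf p {y. f y = f x}) (G x) = (\<Sum>y\<in>S. w x y * G x y)"
      if "x \<in> S" for x
    proof -
      have ne: "set_pmf p \<inter> {y. f y = f x} \<noteq> {}"
        using that by (auto simp: S_def)
      have "measure_pmf.expectation (cond_pmf p {y. f y = f x}) (G x) =
          (\<Sum>y\<in>S. G x y * pmf (cond_pmf p {y. f y = f x}) y)"
        by (rule integral_measure_pmf_real) (use fin ne in \<open>auto simp: S_def\<close>)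
      then show ?thesis
        by (auto simp: pmf_cond[OF ne] w_def sum_distrib_left intro!: sum.cong)
    qed
    then show ?thesis
      by (subst integral_measure_pmf_real[where A = S])
        (use fin in \<open>auto simp: S_def mult.commute intro!: sum.cong\<close>)
  qed
  have "(\<Sum>x\<in>S. \<Sum>y\<in>S. w x y * F x y) = (\<Sum>x\<in>S. \<Sum>y\<in>S. w x y * F y x)"
    by (subst sum.swap) (simp add: w_sym)
  then show ?thesis
    by (simp add: double_sum)
qed

text \<open>After the swap the inner integrand is \<open>G x (f y)\<close>, which is constant on the
  fibre through \<open>x\<close>, so the inner expectation disappears.\<close>

lemma expectation_cond_pmf_tower:
  fixes p :: "'a pmf" and f :: "'a \<Rightarrow> 'b" and G :: "'a \<Rightarrow> 'b \<Rightarrow> real"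
  assumes fin: "finite (set_pmf p)"
  shows "measure_pmf.expectation p (\<lambda>x. measure_pmf.expectation (cond_pmf p {y. f y = f x}) (\<lambda>y. G y (f x))) =
         measure_pmf.expectation p (\<lambda>x. G x (f x))"
proof -
  have "measure_pmf.expectation (cond_pmf p {y. f y = f x}) (\<lambda>y. G x (f y)) = G x (f x)"
    if "x \<in> set_pmf p" for x
  proof -
    have ne: "set_pmf p \<inter> {y. f y = f x} \<noteq> {}"
      using that by auto
    have "measure_pmf.expectation (cond_pmf p {y. f y = f x}) (\<lambda>y. G x (f y)) =
        measure_pmf.expectation (cond_pmf p {y. f y = f x}) (\<lambda>y. G x (f x))"
      by (intro integral_cong_AE) (auto simp: AE_measure_pmf_iff set_cond_pmf[OF ne])
    then show ?thesis by simp
  qed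
  then show ?thesis
    by (subst expectation_cond_pmf_swap[OF fin])
      (intro integral_cong_AE, auto simp: AE_measure_pmf_iff)
qed

section \<open>Dimensions along paths of the support\<close>

lemma take_in_hist_space:
  assumes "well_formed M" "\<xi> \<in> support M" "t \<le> horizon M"
  shows "take t \<xi> \<in> hist_space M t"
  using assms by (fastforce simp: well_formed_def hist_space_def)

lemma well_formed_carrier:
  assumes "well_formed M" "\<xi> \<in> support M" "t \<in> stage_set M"
  shows "cost M t (take t \<xi>) \<in> carrier_vec (var_dim M t)"
    and "A_mat M t (take t \<xi>) \<in> carrier_mat (eq_dim M t) (var_dim M t)"
    and "B_mat M t (take t \<xi>) \<in> carrier_mat (eq_dim M t) (var_dim M (t - 1))"
    and "b_vec M t (take t \<xi>) \<in> carrier_vec (eq_dim M t)"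
proof -
  have "take t \<xi> \<in> hist_space M t"
    using take_in_hist_space assms by (auto simp: stage_set_def)
  then show "cost M t (take t \<xi>) \<in> carrier_vec (var_dim M t)"
    and "A_mat M t (take t \<xi>) \<in> carrier_mat (eq_dim M t) (var_dim M t)"
    and "B_mat M t (take t \<xi>) \<in> carrier_mat (eq_dim M t) (var_dim M (t - 1))"
    and "b_vec M t (take t \<xi>) \<in> carrier_vec (eq_dim M t)"
    using assms unfolding well_formed_def by blast+
qed

lemma X_set_carrier: "v \<in> X_set M t h \<Longrightarrow> v \<in> carrier_vec (var_dim M t)"
  by (simp add: X_set_def mixed_integer_def)

section \<open>Both Lagrangians as expected sums of the same stage values\<close>

text \<open>The share of the stage \<open>Suc t\<close> state equation that is caused by the
  decision of stage \<open>t\<close>. It needs the path rather than the stage-\<open>t\<close>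
  history, since \<open>B_mat\<close> and \<open>\<pi>\<close> at stage \<open>Suc t\<close> see one
  more observation.\<close>

definition next_penalty ::
    "msmip \<Rightarrow> (nat \<Rightarrow> real vec list \<Rightarrow> real vec) \<Rightarrow> nat \<Rightarrow> real vec list \<Rightarrow> real vec \<Rightarrow> real" where
  "next_penalty M \<pi> t \<xi> v =
     (if t < horizon M
      then scalar_prod (\<pi> (Suc t) (take (Suc t) \<xi>)) (B_mat M (Suc t) (take (Suc t) \<xi>) *\<^sub>v v)
      else 0)"

text \<open>The contribution of a decision to the Lagrangian at the node \<open>h\<close>. Averaging
  the next penalty over the continuations of \<open>h\<close> leaves a function of node and decision
  only, which can be minimized node by node.\<close>

definition stage_value ::
    "msmip \<Rightarrow> (nat \<Rightarrow> real vec list \<Rightarrow> real vec) \<Rightarrow> nat \<Rightarrow> real vec list \<Rightarrow> real vec \<Rightarrow> real" where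
  "stage_value M \<pi> t h v =
     scalar_prod (cost M t h) v + scalar_prod (\<pi> t h) (A_mat M t h *\<^sub>v v) +
     measure_pmf.expectation (cond_pmf (path_law M) {\<xi>'. take t \<xi>' = h}) (\<lambda>\<xi>'. next_penalty M \<pi> t \<xi>' v) -
     scalar_prod (\<pi> t h) (b_vec M t h)"

definition dual_multipliers :: "msmip \<Rightarrow> (nat \<Rightarrow> real vec list \<Rightarrow> real vec) \<Rightarrow> bool" where
  "dual_multipliers M \<pi> \<longleftrightarrow>
     (\<forall>t\<in>stage_set M. \<forall>\<xi>\<in>support M. \<pi> t (take t \<xi>) \<in> carrier_vec (eq_dim M t))"

text \<open>Summation by parts along one path: the term with \<open>B_mat\<close> is moved from the
  stage whose equation contains it to the preceding stage, whose decision it multiplies.\<close>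

lemma lagrangian_by_stage:
  assumes wf: "well_formed M" and \<pi>: "dual_multipliers M \<pi>" and \<xi>: "\<xi> \<in> support M"
    and x: "\<And>t. t \<in> stage_set M \<Longrightarrow> x t \<in> carrier_vec (var_dim M t)"
  shows "(\<Sum>t\<in>stage_set M. scalar_prod (cost M t (take t \<xi>)) (x t) +
            scalar_prod (\<pi> t (take t \<xi>)) (state_lhs M t (take t \<xi>) x - b_vec M t (take t \<xi>))) =
         (\<Sum>t\<in>stage_set M. scalar_prod (cost M t (take t \<xi>)) (x t) +
            scalar_prod (\<pi> t (take t \<xi>)) (A_mat M t (take t \<xi>) *\<^sub>v x t) + next_penalty M \<pi> t \<xi> (x t) -
            scalar_prod (\<pi> t (take t \<xi>)) (b_vec M t (take t \<xi>)))"
proof -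
  define P where
    "P t = scalar_prod (\<pi> t (take t \<xi>)) (B_mat M t (take t \<xi>) *\<^sub>v prev M x t)" for t
  have "scalar_prod (\<pi> t (take t \<xi>)) (state_lhs M t (take t \<xi>) x - b_vec M t (take t \<xi>)) =
      scalar_prod (\<pi> t (take t \<xi>)) (A_mat M t (take t \<xi>) *\<^sub>v x t) + P t -
      scalar_prod (\<pi> t (take t \<xi>)) (b_vec M t (take t \<xi>))"
    if t: "t \<in> stage_set M" for t
  proof -
    note c = well_formed_carrier[OF wf \<xi> t]
    have "t - 1 \<in> stage_set M" if "t \<noteq> 1"
      using t that unfolding stage_set_def atLeastAtMost_iff by linarith
    then have "prev M x t \<in> carrier_vec (var_dim M (t - 1))"
      using x by (simp add: prev_def)
    then have B: "B_mat M t (take t \<xi>) *\<^sub>v prev M x t \<in> carrier_vec (eq_dim M t)"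
      using c by auto
    have A: "A_mat M t (take t \<xi>) *\<^sub>v x t \<in> carrier_vec (eq_dim M t)"
      using c x t by auto
    have "\<pi> t (take t \<xi>) \<in> carrier_vec (eq_dim M t)"
      using \<pi> t \<xi> by (auto simp: dual_multipliers_def)
    then show ?thesis
      using A B c(4) unfolding state_lhs_def P_def
      by (simp add: scalar_prod_minus_distrib[where n = "eq_dim M t"]
          scalar_prod_add_distrib[where n = "eq_dim M t"])
  qed
  \<comment> \<open>An index shift with both ends vanishing: \<open>P 1\<close> is zero because the
    decision before stage 1 is zero, and \<open>next_penalty\<close> is zero at the last
    stage.\<close>
  moreover have "(\<Sum>t\<in>stage_set M. P t) = (\<Sum>t\<in>stage_set M. next_penalty M \<pi> t \<xi> (x t))"
  proof -
    obtain N where N: "horizon M = Suc N"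
      using wf by (cases "horizon M") (auto simp: well_formed_def)
    have 1: "1 \<in> stage_set M"
      by (simp add: stage_set_def N)
    have "B_mat M 1 (take 1 \<xi>) *\<^sub>v 0\<^sub>v (var_dim M 0) = 0\<^sub>v (eq_dim M 1)"
      using well_formed_carrier(3)[OF wf \<xi> 1] by auto
    moreover have "\<pi> 1 (take 1 \<xi>) \<in> carrier_vec (eq_dim M 1)"
      using \<pi> 1 \<xi> unfolding dual_multipliers_def by blast
    ultimately have P1: "P 1 = 0"
      by (simp add: P_def prev_def)
    have "(\<Sum>t\<in>stage_set M. P t) = P 1 + (\<Sum>t=1..N. P (Suc t))"
      unfolding stage_set_def N
      by (subst sum.atLeast_Suc_atMost) (simp_all add: sum.shift_bounds_cl_Suc_ivl del: sum.cl_ivl_Suc)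
    also have "\<dots> = (\<Sum>t=1..N. next_penalty M \<pi> t \<xi> (x t))"
      unfolding P1 by (auto simp: P_def next_penalty_def prev_def N intro!: sum.cong)
    also have "\<dots> = (\<Sum>t\<in>stage_set M. next_penalty M \<pi> t \<xi> (x t))"
      by (simp add: stage_set_def N next_penalty_def)
    finally show ?thesis .
  qed
  ultimately show ?thesis
    by (simp add: sum.distrib sum_subtractf)
qed

lemma integrable_path_law:
  "finite (support M) \<Longrightarrow> integrable (measure_pmf (path_law M)) (f :: _ \<Rightarrow> real)"
  by (simp add: support_def integrable_measure_pmf_finite)

lemma SW_objective_by_stage:
  assumes wf: "well_formed M" and fin: "finite (support M)" and \<pi>: "dual_multipliers M \<pi>"
    and x: "x \<in> SW_policies M"
  shows "SW_objective M \<pi> x = measure_pmf.expectation (path_law M)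
    (\<lambda>\<xi>. \<Sum>t\<in>stage_set M. stage_value M \<pi> t (take t \<xi>) (x t (take t \<xi>)))"
proof -
  let ?E = "measure_pmf.expectation (path_law M)"
  have finp: "finite (set_pmf (path_law M))"
    using fin by (simp add: support_def)
  define R where "R = (\<lambda>t \<xi>. scalar_prod (cost M t (take t \<xi>)) (x t (take t \<xi>)) +
      scalar_prod (\<pi> t (take t \<xi>)) (A_mat M t (take t \<xi>) *\<^sub>v x t (take t \<xi>)) -
      scalar_prod (\<pi> t (take t \<xi>)) (b_vec M t (take t \<xi>)))"
  have "SW_objective M \<pi> x =
      ?E (\<lambda>\<xi>. \<Sum>t\<in>stage_set M. R t \<xi> + next_penalty M \<pi> t \<xi> (x t (take t \<xi>)))"
    unfolding SW_objective_def
  proof (intro integral_cong_AE)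
    have "(\<Sum>t\<in>stage_set M. scalar_prod (cost M t (take t \<xi>)) (x t (take t \<xi>)) +
        scalar_prod (\<pi> t (take t \<xi>)) (state_lhs M t (take t \<xi>) (along x \<xi>) - b_vec M t (take t \<xi>))) =
        (\<Sum>t\<in>stage_set M. R t \<xi> + next_penalty M \<pi> t \<xi> (x t (take t \<xi>)))" if "\<xi> \<in> support M" for \<xi>
    proof -
      have along: "along x \<xi> = (\<lambda>t. x t (take t \<xi>))"
        by (simp add: along_def fun_eq_iff)
      have "along x \<xi> t \<in> carrier_vec (var_dim M t)" if "t \<in> stage_set M" for t
        using x \<open>\<xi> \<in> support M\<close> that
        by (auto simp: along SW_policies_def intro: X_set_carrier)
      from lagrangian_by_stage[OF wf \<pi> that this] show ?thesis
        by (simp add: along R_def algebra_simps)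
    qed
    then show "AE \<xi> in measure_pmf (path_law M).
        (\<Sum>t\<in>stage_set M. scalar_prod (cost M t (take t \<xi>)) (x t (take t \<xi>)) +
        scalar_prod (\<pi> t (take t \<xi>)) (state_lhs M t (take t \<xi>) (along x \<xi>) - b_vec M t (take t \<xi>))) =
        (\<Sum>t\<in>stage_set M. R t \<xi> + next_penalty M \<pi> t \<xi> (x t (take t \<xi>)))"
      by (simp add: AE_measure_pmf_iff support_def)
  qed simp_all
  also have "\<dots> = (\<Sum>t\<in>stage_set M. ?E (R t) + ?E (\<lambda>\<xi>. next_penalty M \<pi> t \<xi> (x t (take t \<xi>))))"
    by (simp add: integrable_path_law[OF fin])
  \<comment> \<open>The decision is a function of the history alone, so it stays fixed while the
    penalty is averaged over the paths sharing that history.\<close>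
  also have "\<dots> = (\<Sum>t\<in>stage_set M. ?E (R t) + ?E (\<lambda>\<xi>.
      measure_pmf.expectation (cond_pmf (path_law M) {\<xi>'. take t \<xi>' = take t \<xi>})
        (\<lambda>\<xi>'. next_penalty M \<pi> t \<xi>' (x t (take t \<xi>)))))"
    using expectation_cond_pmf_tower[OF finp, of "take _" "\<lambda>\<xi> h. next_penalty M \<pi> _ \<xi> (x _ h)"] by simp
  also have "\<dots> = ?E (\<lambda>\<xi>. \<Sum>t\<in>stage_set M. stage_value M \<pi> t (take t \<xi>) (x t (take t \<xi>)))"
    by (simp add: integrable_path_law[OF fin] stage_value_def R_def algebra_simps)
  finally show ?thesis .
qed

text \<open>Linearity of the conditional expectation, which is defined componentwise. The dimension
  of \<open>f\<close> matters because \<open>scalar_prod\<close> sums over the indices of its second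
  argument.\<close>

lemma scalar_prod_cond_expect:
  assumes fin: "finite (support M)" and \<xi>: "\<xi> \<in> support M"
    and f: "\<And>\<xi>'. \<xi>' \<in> support M \<Longrightarrow> f \<xi>' \<in> carrier_vec n"
  shows "scalar_prod u (cond_expect M n t f (take t \<xi>)) =
    measure_pmf.expectation (cond_pmf (path_law M) {\<xi>'. take t \<xi>' = take t \<xi>}) (\<lambda>\<xi>'. scalar_prod u (f \<xi>'))"
proof -
  let ?q = "cond_pmf (path_law M) {\<xi>'. take t \<xi>' = take t \<xi>}"
  have "set_pmf (path_law M) \<inter> {\<xi>'. take t \<xi>' = take t \<xi>} \<noteq> {}"
    using \<xi> by (auto simp: support_def)
  note q = set_cond_pmf[OF this]
  have int: "integrable (measure_pmf ?q) g" for g :: "real vec list \<Rightarrow> real"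
    using fin by (intro integrable_measure_pmf_finite) (auto simp: q support_def)
  have "scalar_prod u (cond_expect M n t f (take t \<xi>)) =
      measure_pmf.expectation ?q (\<lambda>\<xi>'. \<Sum>i = 0..<n. u $ i * f \<xi>' $ i)"
    by (simp add: scalar_prod_def cond_expect_def int)
  also have "\<dots> = measure_pmf.expectation ?q (\<lambda>\<xi>'. scalar_prod u (f \<xi>'))"
    using carrier_vecD[OF f]
    by (intro integral_cong_AE) (auto simp: AE_measure_pmf_iff q scalar_prod_def support_def)
  finally show ?thesis .
qed

lemma NA_objective_by_stage:
  assumes wf: "well_formed M" and fin: "finite (support M)" and \<pi>: "dual_multipliers M \<pi>"
    and y: "y \<in> NA_policies M"
    and \<gamma>: "\<And>t \<xi>. t \<in> stage_set M \<Longrightarrow> \<xi> \<in> support M \<Longrightarrow> \<gamma> t \<xi> \<in> carrier_vec (var_dim M t)"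
    and \<gamma>_eq: "\<And>t \<xi> v. t \<in> stage_set M \<Longrightarrow> \<xi> \<in> support M \<Longrightarrow> v \<in> carrier_vec (var_dim M t) \<Longrightarrow>
      scalar_prod (\<gamma> t \<xi>) v = - next_penalty M \<pi> t \<xi> v"
  shows "NA_objective M \<gamma> y = measure_pmf.expectation (path_law M)
    (\<lambda>\<xi>. \<Sum>t\<in>stage_set M. stage_value M \<pi> t (take t \<xi>) (y t \<xi>))"
proof -
  let ?E = "measure_pmf.expectation (path_law M)"
  let ?C = "\<lambda>t \<xi>. measure_pmf.expectation (cond_pmf (path_law M) {\<xi>'. take t \<xi>' = take t \<xi>})"
  have finp: "finite (set_pmf (path_law M))"
    using fin by (simp add: support_def)
  have yc: "y t \<xi> \<in> carrier_vec (var_dim M t)"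
    and yeq: "state_lhs M t (take t \<xi>) (\<lambda>t. y t \<xi>) = b_vec M t (take t \<xi>)"
    if "t \<in> stage_set M" "\<xi> \<in> support M" for t \<xi>
    using y that by (auto simp: NA_policies_def Y_set_def mixed_integer_def)
  define R where "R = (\<lambda>t \<xi>. scalar_prod (cost M t (take t \<xi>)) (y t \<xi>) +
      scalar_prod (\<pi> t (take t \<xi>)) (A_mat M t (take t \<xi>) *\<^sub>v y t \<xi>) -
      scalar_prod (\<pi> t (take t \<xi>)) (b_vec M t (take t \<xi>)))"
  \<comment> \<open>Policies in \<open>NA_policies\<close> satisfy the state equations, so the
    residuals weighted by \<open>\<pi>\<close> are zero and may be added to the cost for
    free.\<close>
  have cost_eq: "(\<Sum>t\<in>stage_set M. scalar_prod (cost M t (take t \<xi>)) (y t \<xi>)) =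
      (\<Sum>t\<in>stage_set M. R t \<xi> + next_penalty M \<pi> t \<xi> (y t \<xi>))" if \<xi>: "\<xi> \<in> support M" for \<xi>
  proof -
    have "scalar_prod (\<pi> t (take t \<xi>))
        (state_lhs M t (take t \<xi>) (\<lambda>t. y t \<xi>) - b_vec M t (take t \<xi>)) = 0"
      if t: "t \<in> stage_set M" for t
    proof -
      have "\<pi> t (take t \<xi>) \<in> carrier_vec (eq_dim M t)"
        using \<pi> t \<xi> by (auto simp: dual_multipliers_def)
      then show ?thesis
        using well_formed_carrier(4)[OF wf \<xi> t] yeq[OF t \<xi>] by simp
    qed
    then show ?thesis
      using lagrangian_by_stage[OF wf \<pi> \<xi>, of "\<lambda>t. y t \<xi>"] yc \<xi>
      by (simp add: R_def algebra_simps)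
  qed
  have pen: "scalar_prod (\<gamma> t \<xi>) (y t \<xi> - cond_expect M (var_dim M t) t (y t) (take t \<xi>)) =
      ?C t \<xi> (\<lambda>\<xi>'. next_penalty M \<pi> t \<xi> (y t \<xi>')) - next_penalty M \<pi> t \<xi> (y t \<xi>)"
    if t: "t \<in> stage_set M" and \<xi>: "\<xi> \<in> support M" for t \<xi>
  proof -
    have ne: "set_pmf (path_law M) \<inter> {\<xi>'. take t \<xi>' = take t \<xi>} \<noteq> {}"
      using \<xi> by (auto simp: support_def)
    have "?C t \<xi> (\<lambda>\<xi>'. scalar_prod (\<gamma> t \<xi>) (y t \<xi>')) = ?C t \<xi> (\<lambda>\<xi>'. - next_penalty M \<pi> t \<xi> (y t \<xi>'))"
      using \<gamma>_eq yc t \<xi>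
      by (intro integral_cong_AE) (auto simp: AE_measure_pmf_iff set_cond_pmf[OF ne] support_def)
    moreover have "cond_expect M (var_dim M t) t (y t) (take t \<xi>) \<in> carrier_vec (var_dim M t)"
      by (simp add: cond_expect_def)
    ultimately show ?thesis
      using scalar_prod_minus_distrib[OF \<gamma>[OF t \<xi>] yc[OF t \<xi>]]
        scalar_prod_cond_expect[OF fin \<xi> yc[OF t]] \<gamma>_eq[OF t \<xi> yc[OF t \<xi>]]
      by simp
  qed
  \<comment> \<open>The own-path penalties occur with opposite signs in \<open>cost_eq\<close> and
    \<open>pen\<close> and cancel.\<close>
  have "NA_objective M \<gamma> y =
      ?E (\<lambda>\<xi>. \<Sum>t\<in>stage_set M. R t \<xi> + ?C t \<xi> (\<lambda>\<xi>'. next_penalty M \<pi> t \<xi> (y t \<xi>')))"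
    unfolding NA_objective_def
    by (intro integral_cong_AE)
      (auto simp: AE_measure_pmf_iff pen cost_eq sum.distrib sum_subtractf simp flip: support_def)
  also have "\<dots> = (\<Sum>t\<in>stage_set M. ?E (R t) + ?E (\<lambda>\<xi>. ?C t \<xi> (\<lambda>\<xi>'. next_penalty M \<pi> t \<xi> (y t \<xi>'))))"
    by (simp add: integrable_path_law[OF fin])
  \<comment> \<open>Exchangeability of two paths with a common history: the penalty now varies over
    the continuations, and the decision is that of the outer path.\<close>
  also have "\<dots> = (\<Sum>t\<in>stage_set M. ?E (R t) + ?E (\<lambda>\<xi>. ?C t \<xi> (\<lambda>\<xi>'. next_penalty M \<pi> t \<xi>' (y t \<xi>))))"
    using expectation_cond_pmf_swap[OF finp, of "take _" "\<lambda>\<xi> \<xi>'. next_penalty M \<pi> _ \<xi> (y _ \<xi>')"] by simp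
  also have "\<dots> = ?E (\<lambda>\<xi>. \<Sum>t\<in>stage_set M. stage_value M \<pi> t (take t \<xi>) (y t \<xi>))"
    by (simp add: integrable_path_law[OF fin] stage_value_def R_def algebra_simps)
  finally show ?thesis .
qed

section \<open>Comparison of the two Lagrangians\<close>

text \<open>At each node the decision is copied from a path through that node that minimizes
  \<open>g\<close>. Decisions of different paths may be combined because \<open>SW_policies\<close>
  imposes only membership in \<open>X_set\<close>, which depends on the node, and no state equation
  linking stages.\<close>

lemma SW_policy_below_NA_policy:
  fixes g :: "nat \<Rightarrow> real vec list \<Rightarrow> real vec \<Rightarrow> real"
  assumes fin: "finite (support M)" and y: "y \<in> NA_policies M"
  obtains x where "x \<in> SW_policies M"
    and "\<And>t \<xi>. \<xi> \<in> support M \<Longrightarrow> g t (take t \<xi>) (x t (take t \<xi>)) \<le> g t (take t \<xi>) (y t \<xi>)"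
proof -
  define best where
    "best t h = arg_min_on (\<lambda>\<xi>. g t h (y t \<xi>)) {\<xi> \<in> support M. take t \<xi> = h}" for t h
  define x where "x t h = y t (best t h)" for t h
  have best: "best t (take t \<xi>) \<in> support M" "take t (best t (take t \<xi>)) = take t \<xi>"
    "g t (take t \<xi>) (y t (best t (take t \<xi>))) \<le> g t (take t \<xi>) (y t \<xi>)"
    if \<xi>: "\<xi> \<in> support M" for t \<xi>
  proof -
    let ?P = "{\<xi>' \<in> support M. take t \<xi>' = take t \<xi>}"
    have P: "finite ?P" "\<xi> \<in> ?P"
      using fin \<xi> by auto
    have "best t (take t \<xi>) \<in> ?P"
      unfolding best_def by (rule arg_min_if_finite(1)) (use P in auto)
    then show "best t (take t \<xi>) \<in> support M" "take t (best t (take t \<xi>)) = take t \<xi>"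
      by auto
    show "g t (take t \<xi>) (y t (best t (take t \<xi>))) \<le> g t (take t \<xi>) (y t \<xi>)"
      unfolding best_def by (rule arg_min_least) (use P in auto)
  qed
  have "x t (take t \<xi>) \<in> X_set M t (take t \<xi>)" if "\<xi> \<in> support M" "t \<in> stage_set M" for t \<xi>
    using y best(1,2)[OF that(1), of t] that(2)
    unfolding x_def NA_policies_def Y_set_def by fastforce
  then have "x \<in> SW_policies M"
    by (simp add: SW_policies_def)
  then show thesis
    using best(3) by (intro that) (auto simp: x_def)
qed

text \<open>The last assumption says that \<open>\<gamma>\<close> at stage \<open>t\<close> is minus
  the transpose of the next \<open>B_mat\<close> applied to the next \<open>\<pi>\<close>, tested
  against vectors. The infima compare because every nonanticipative-dual policy has a stagewise
  policy of no larger objective.\<close>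

lemma SW_lagrangian_le_NA_lagrangian:
  assumes wf: "well_formed M" and fin: "finite (support M)" and \<pi>: "dual_multipliers M \<pi>"
    and \<gamma>: "\<And>t \<xi>. t \<in> stage_set M \<Longrightarrow> \<xi> \<in> support M \<Longrightarrow> \<gamma> t \<xi> \<in> carrier_vec (var_dim M t)"
    and \<gamma>_eq: "\<And>t \<xi> v. t \<in> stage_set M \<Longrightarrow> \<xi> \<in> support M \<Longrightarrow> v \<in> carrier_vec (var_dim M t) \<Longrightarrow>
      scalar_prod (\<gamma> t \<xi>) v = - next_penalty M \<pi> t \<xi> v"
  shows "SW_lagrangian M \<pi> \<le> NA_lagrangian M \<gamma>"
  unfolding SW_lagrangian_def NA_lagrangian_def
proof (rule INF_mono)
  fix y assume y: "y \<in> NA_policies M"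
  obtain x where x: "x \<in> SW_policies M"
    and le: "\<And>t \<xi>. \<xi> \<in> support M \<Longrightarrow>
      stage_value M \<pi> t (take t \<xi>) (x t (take t \<xi>)) \<le> stage_value M \<pi> t (take t \<xi>) (y t \<xi>)"
    using SW_policy_below_NA_policy[OF fin y, where g = "stage_value M \<pi>"] by blast
  have NA: "NA_objective M \<gamma> y = measure_pmf.expectation (path_law M)
      (\<lambda>\<xi>. \<Sum>t\<in>stage_set M. stage_value M \<pi> t (take t \<xi>) (y t \<xi>))"
    by (rule NA_objective_by_stage[OF wf fin \<pi> y]) (fact \<gamma> \<gamma>_eq)+
  have "SW_objective M \<pi> x \<le> NA_objective M \<gamma> y"
    unfolding SW_objective_by_stage[OF wf fin \<pi> x] NA
    using le by (intro integral_mono_AE integrable_path_law[OF fin])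
      (auto simp: AE_measure_pmf_iff intro!: sum_mono simp flip: support_def)
  with x show "\<exists>x\<in>SW_policies M. ereal (SW_objective M \<pi> x) \<le> ereal (NA_objective M \<gamma> y)"
    by auto
qed

section \<open>Choice of the basis functions and coefficients\<close>

theorem theorem1:
  fixes M :: msmip
    and K :: "nat \<Rightarrow> nat"
    and \<Phi> :: "nat \<Rightarrow> real vec list \<Rightarrow> real mat"
  assumes "well_formed M"
    and "finite (support M)"
    and "relatively_complete_recourse M"
    and "bounded_decisions M"
    and "SW_basis M K \<Phi>"
  shows "\<exists>K' \<Psi>. NA_basis M K' \<Psi> \<and>
    restricted_SW_value M K \<Phi> \<le> restricted_NA_value M K' \<Psi>"
proof -
  \<comment> \<open>Stage \<open>t\<close> inherits the basis of stage \<open>Suc t\<close>. The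
    last stage has no successor and gets a basis with zero columns.\<close>
  define K' where "K' t = (if t < horizon M then K (Suc t) else 0)" for t
  \<comment> \<open>Looking one observation ahead is allowed here, since these basis functions may
    depend on the entire path.\<close>
  define \<Psi> where "\<Psi> t \<xi> = (if t < horizon M
      then - (transpose_mat (B_mat M (Suc t) (take (Suc t) \<xi>)) * \<Phi> (Suc t) (take (Suc t) \<xi>))
      else 0\<^sub>m (var_dim M t) 0)" for t \<xi>
  have B: "B_mat M (Suc t) (take (Suc t) \<xi>) \<in> carrier_mat (eq_dim M (Suc t)) (var_dim M t)"
    and F: "\<Phi> (Suc t) (take (Suc t) \<xi>) \<in> carrier_mat (eq_dim M (Suc t)) (K (Suc t))"
    if "t < horizon M" "\<xi> \<in> hist_space M (horizon M)" for t \<xi>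
  proof -
    have "take (Suc t) \<xi> \<in> hist_space M (Suc t)" "Suc t \<in> stage_set M"
      using that by (auto simp: hist_space_def stage_set_def)
    then show "B_mat M (Suc t) (take (Suc t) \<xi>) \<in> carrier_mat (eq_dim M (Suc t)) (var_dim M t)"
      and "\<Phi> (Suc t) (take (Suc t) \<xi>) \<in> carrier_mat (eq_dim M (Suc t)) (K (Suc t))"
      using assms(1,5) unfolding well_formed_def SW_basis_def by (metis diff_Suc_1)+
  qed
  have basis: "NA_basis M K' \<Psi>"
    unfolding NA_basis_def \<Psi>_def K'_def
    by (simp add: mult_carrier_mat[OF transpose_carrier_mat[THEN iffD2, OF B] F])
  have supp: "\<xi> \<in> hist_space M (horizon M)" if "\<xi> \<in> support M" for \<xi>
    using assms(1) that by (auto simp: well_formed_def)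
  have "restricted_SW_value M K \<Phi> \<le> restricted_NA_value M K' \<Psi>"
    unfolding restricted_SW_value_def restricted_NA_value_def
  proof (rule SUP_mono)
    fix \<beta> assume \<beta>: "\<beta> \<in> coefficients M K"
    \<comment> \<open>The coefficients shift with the basis. \<open>\<beta> 1\<close> has no
      counterpart, as there is no decision before stage 1 to be penalized.\<close>
    define \<alpha> where "\<alpha> t = (if t < horizon M then \<beta> (Suc t) else 0\<^sub>v 0)" for t
    have \<beta>c: "\<beta> (Suc t) \<in> carrier_vec (K (Suc t))" if "t < horizon M" for t
      using \<beta> that by (auto simp: coefficients_def stage_set_def)
    have \<alpha>: "\<alpha> \<in> coefficients M K'"
      using \<beta>c by (auto simp: coefficients_def \<alpha>_def K'_def)
    have \<pi>: "dual_multipliers M (\<lambda>t h. \<Phi> t h *\<^sub>v \<beta> t)"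
      unfolding dual_multipliers_def
    proof (intro ballI)
      fix t \<xi> assume t: "t \<in> stage_set M" and "\<xi> \<in> support M"
      then have "take t \<xi> \<in> hist_space M t"
        using take_in_hist_space[OF assms(1)] by (auto simp: stage_set_def)
      then have "\<Phi> t (take t \<xi>) \<in> carrier_mat (eq_dim M t) (K t)" "\<beta> t \<in> carrier_vec (K t)"
        using assms(5) \<beta> t by (auto simp: SW_basis_def coefficients_def)
      then show "\<Phi> t (take t \<xi>) *\<^sub>v \<beta> t \<in> carrier_vec (eq_dim M t)"
        by simp
    qed
    have "SW_lagrangian M (\<lambda>t h. \<Phi> t h *\<^sub>v \<beta> t) \<le> NA_lagrangian M (\<lambda>t \<xi>. \<Psi> t \<xi> *\<^sub>v \<alpha> t)"
    proof (rule SW_lagrangian_le_NA_lagrangian[OF assms(1,2) \<pi>])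
      fix t \<xi> assume t: "t \<in> stage_set M" and \<xi>: "\<xi> \<in> support M"
      have "\<Psi> t \<xi> \<in> carrier_mat (var_dim M t) (K' t)"
        using basis t supp[OF \<xi>] by (auto simp: NA_basis_def)
      moreover have "\<alpha> t \<in> carrier_vec (K' t)"
        using \<alpha> t by (auto simp: coefficients_def)
      ultimately show "\<Psi> t \<xi> *\<^sub>v \<alpha> t \<in> carrier_vec (var_dim M t)"
        by simp
      fix v :: "real vec" assume v: "v \<in> carrier_vec (var_dim M t)"
      show "scalar_prod (\<Psi> t \<xi> *\<^sub>v \<alpha> t) v = - next_penalty M (\<lambda>t h. \<Phi> t h *\<^sub>v \<beta> t) t \<xi> v"
      proof (cases "t < horizon M")
        case True
        let ?B = "B_mat M (Suc t) (take (Suc t) \<xi>)" and ?F = "\<Phi> (Suc t) (take (Suc t) \<xi>)"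
        note c = B[OF True supp[OF \<xi>]] F[OF True supp[OF \<xi>]] \<beta>c[OF True]
        have "\<Psi> t \<xi> *\<^sub>v \<alpha> t = - (transpose_mat ?B *\<^sub>v (?F *\<^sub>v \<beta> (Suc t)))"
          using c True by (simp add: \<Psi>_def \<alpha>_def)
        \<comment> \<open>The transpose moves \<open>?B\<close> from the multiplier onto
          \<open>v\<close>.\<close>
        then show ?thesis
          using c v True transpose_vec_mult_scalar[OF c(1) v mult_mat_vec_carrier[OF c(2,3)]]
          by (simp add: next_penalty_def)
      next
        case False
        \<comment> \<open>A matrix without columns maps the empty coefficient vector to zero,
          matching the zero penalty of the last stage.\<close>
        then show ?thesis
          using v by (auto simp: \<Psi>_def \<alpha>_def next_penalty_def scalar_prod_def)
      qed
    qed
    with \<alpha> show "\<exists>\<alpha>\<in>coefficients M K'. SW_lagrangian M (\<lambda>t h. \<Phi> t h *\<^sub>v \<beta> t)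
        \<le> NA_lagrangian M (\<lambda>t \<xi>. \<Psi> t \<xi> *\<^sub>v \<alpha> t)"
      by blast
  qed
  with basis show ?thesis
    by blast
qed

end
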